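(* Any Hausdorff feebly compact periodic paratopological group is a topological group.
   Context: A paratopological group is a group with a topology such that the multiplication is continuous; it is a topological group if moreover inversion is continuous. A group is periodic if each of its elements has finite order. A space is feebly compact if each locally finite family of its open subsets is finite. *)

theory Defs
  imports "HOL-Analysis.Abstract_Topology" "HOL-Analysis.Product_Topology"
    "HOL-Analysis.T1_Spaces" "HOL-Algebra.Multiplicative_Group"
begin

locale paratopological_group = group G
  for G :: "('a, 'b) monoid_scheme" (structure) +
  fixes X :: "'a topology"
  assumes topspace_eq_carrier: "topspace X = carrier G"
    and continuous_mult: "continuous_map (prod_topology X X) X (\<lambda>(x, y). x \<otimes> y)"

locale topological_group = paratopological_group G X
  for G :: "('a, 'b) monoid_scheme" (structure) and X :: "'a topology" +
  assumes continuous_inv: "continuous_map X X (\<lambda>x. inv x)"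

text \<open>The library's \<^const>\<open>group.ord\<close> assigns \<open>0\<close> to elements of infinite order.\<close>

locale periodic_group = group G
  for G :: "('a, 'b) monoid_scheme" (structure) +
  assumes finite_ord: "x \<in> carrier G \<Longrightarrow> ord x \<noteq> 0"

text \<open>
  Families are sets of open sets. This agrees with the reading by indexed families of
  \<^emph>\<open>nonempty\<close> open sets, since a locally finite indexed family repeats each nonempty
  member only finitely often.
\<close>

definition feebly_compact_space :: "'a topology \<Rightarrow> bool" where
  "feebly_compact_space X \<longleftrightarrow>
     (\<forall>\<U>. (\<forall>U\<in>\<U>. openin X U) \<and> locally_finite_in X \<U> \<longrightarrow> finite \<U>)"

end

theory Submission
  imports Defs
begin

text \<open>
  The group is the union of the countably many closed sets \<open>{x. x\<^sup>n = \<one>}\<close> with \<open>n \<ge> 1\<close>.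
  A Baire category argument shows that one of them contains a nonempty open set. Regularity,
  which usually allows to shrink open sets, is replaced by the Hausdorff property applied to
  \<open>x\<^sup>n\<close> and \<open>\<one>\<close>. On the open set obtained, inversion is the power map with exponent \<open>n - 1\<close>
  and hence continuous; by translation it is continuous everywhere.
\<close>

text \<open>If the closures had no common point, each point would have a neighbourhood missing some
  \<open>W n\<close>, and hence all later ones. So \<open>range W\<close> would be locally finite
  and therefore finite.\<close>

lemma feebly_compact_space_decseq_closures:
  fixes W :: "nat \<Rightarrow> 'a set"
  assumes "feebly_compact_space X"
    and op: "\<And>n. openin X (W n)" and ne: "\<And>n. W n \<noteq> {}" and dec: "decseq W"
  shows "(\<Inter>n. X closure_of W n) \<noteq> {}"
proof
  assume empty: "(\<Inter>n. X closure_of W n) = {}"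
  have "locally_finite_in X (range W)"
    unfolding locally_finite_in_def
  proof (intro conjI ballI)
    show "\<Union> (range W) \<subseteq> topspace X"
      using op openin_subset by blast
  next
    fix x assume x: "x \<in> topspace X"
    obtain n where "x \<notin> X closure_of W n"
      using empty by blast
    then obtain V where V: "openin X V" "x \<in> V" "W n \<inter> V = {}"
      using x by (auto simp: in_closure_of)
    have "{U \<in> range W. U \<inter> V \<noteq> {}} \<subseteq> W ` {..<n}"
    proof
      fix U assume "U \<in> {U \<in> range W. U \<inter> V \<noteq> {}}"
      then obtain m where m: "U = W m" "W m \<inter> V \<noteq> {}"
        by auto
      then have "m < n"
        using V(3) decseqD[OF dec, of n m] by (meson disjoint_iff not_less subsetD)
      then show "U \<in> W ` {..<n}"
        using m by auto
    qed
    then have "finite {U \<in> range W. U \<inter> V \<noteq> {}}"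
      using finite_subset by blast
    then show "\<exists>V. openin X V \<and> x \<in> V \<and> finite {U \<in> range W. U \<inter> V \<noteq> {}}"
      using V by blast
  qed
  then have "finite (range W)"
    using assms(1) op unfolding feebly_compact_space_def by blast
  \<comment> \<open>In a decreasing sequence a minimal member is the least one, so the nonempty
    \<open>W k\<close> lies in every closure.\<close>
  then obtain k where k: "\<And>n. W n \<subseteq> W k \<Longrightarrow> W k = W n"
    using finite_has_minimal[of "range W"] by auto
  have "W k \<subseteq> W n" for n
    using k[of "max k n"] decseqD[OF dec, of k "max k n"] decseqD[OF dec, of n "max k n"]
    by simp
  then have "W k \<subseteq> X closure_of W n" for n
    using closure_of_subset[OF openin_subset[OF op]] by blast
  then show False
    using empty ne[of k] by blast
qed

text \<open>Choose \<open>W (Suc n)\<close> inside \<open>W n\<close> with closure missing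
  \<open>F n\<close>; a common point of all closures then lies in no \<open>F n\<close>. The
  hypothesis \<open>shrink\<close> stands in for nowhere density of \<open>F n\<close> combined with
  regularity of the space.\<close>

lemma feebly_compact_space_not_countable_Union:
  fixes F :: "nat \<Rightarrow> 'a set"
  assumes fc: "feebly_compact_space X" and ne: "topspace X \<noteq> {}"
    and shrink: "\<And>n W. openin X W \<Longrightarrow> W \<noteq> {} \<Longrightarrow>
      \<exists>W'. openin X W' \<and> W' \<noteq> {} \<and> W' \<subseteq> W \<and> X closure_of W' \<inter> F n = {}"
  shows "\<not> topspace X \<subseteq> (\<Union>n. F n)"
proof -
  have "\<exists>W. \<forall>n. (openin X (W n) \<and> W n \<noteq> {}) \<and>
      (W (Suc n) \<subseteq> W n \<and> X closure_of W (Suc n) \<inter> F n = {})"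
  proof (rule dependent_nat_choice)
    show "\<exists>W. openin X W \<and> W \<noteq> {}"
      using ne by blast
  next
    fix W n assume "openin X W \<and> W \<noteq> {}"
    then show "\<exists>W'. (openin X W' \<and> W' \<noteq> {}) \<and> (W' \<subseteq> W \<and> X closure_of W' \<inter> F n = {})"
      using shrink[of W n] by blast
  qed
  then obtain W where W: "\<And>n. openin X (W n)" "\<And>n. W n \<noteq> {}"
      "\<And>n. W (Suc n) \<subseteq> W n" "\<And>n. X closure_of W (Suc n) \<inter> F n = {}"
    by blast
  have "decseq W"
    by (rule decseq_SucI) (rule W(3))
  then obtain x where x: "\<And>n. x \<in> X closure_of W n"
    using feebly_compact_space_decseq_closures[of X W, OF fc W(1,2)] by blast
  then have "x \<notin> F n" for n
    using W(4)[of n] by blast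
  moreover have "x \<in> topspace X"
    using x[of 0] closure_of_subset_topspace[of X] by blast
  ultimately show ?thesis
    by blast
qed

context paratopological_group
begin

lemma continuous_map_mult:
  assumes "continuous_map Y X f" "continuous_map Y X g"
  shows "continuous_map Y X (\<lambda>y. f y \<otimes> g y)"
proof -
  have "continuous_map Y (prod_topology X X) (\<lambda>y. (f y, g y))"
    using assms by (simp add: continuous_map_pairedI)
  from continuous_map_compose[OF this continuous_mult] show ?thesis
    by (simp add: o_def)
qed

lemma continuous_map_nat_pow: "continuous_map X X (\<lambda>x. x [^] (n::nat))"
proof (induction n)
  case 0
  then show ?case by (simp add: topspace_eq_carrier)
next
  case (Suc n)
  then show ?case by (simp add: continuous_map_mult)
qed

lemma shrink_avoiding_torsion:
  assumes "Hausdorff_space X" "openin X W" "\<not> W \<subseteq> {x. x [^] (n::nat) = \<one>}"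
  shows "\<exists>W'. openin X W' \<and> W' \<noteq> {} \<and> W' \<subseteq> W \<and> X closure_of W' \<inter> {x. x [^] n = \<one>} = {}"
proof -
  obtain x where x: "x \<in> W" "x [^] n \<noteq> \<one>"
    using assms(3) by blast
  then have "x \<in> carrier G"
    using assms(2) openin_subset topspace_eq_carrier by blast
  then obtain A B where AB: "openin X A" "openin X B" "x [^] n \<in> A" "\<one> \<in> B" "disjnt A B"
    using assms(1) x(2) unfolding Hausdorff_space_def
    by (metis nat_pow_closed one_closed topspace_eq_carrier)
  let ?P = "\<lambda>S. {y \<in> topspace X. y [^] n \<in> S}"
  have P: "openin X (?P A)" "openin X (?P B)"
    using AB openin_continuous_map_preimage[OF continuous_map_nat_pow] by auto
  \<comment> \<open>The preimages of \<open>A\<close> and \<open>B\<close> under the power map are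
    disjoint, and an open set disjoint from a set misses its closure too.\<close>
  have "X closure_of (W \<inter> ?P A) \<inter> ?P B = {}"
    using openin_Int_closure_of_eq_empty[OF P(2), of "W \<inter> ?P A"] AB(5)
    by (auto simp: disjnt_iff)
  \<comment> \<open>The torsion set ranges over the whole type, but its part in
    \<open>topspace X\<close> lies in \<open>?P B\<close> since \<open>\<one> \<in> B\<close>, and
    closures stay in \<open>topspace X\<close>.\<close>
  then have "X closure_of (W \<inter> ?P A) \<inter> {x. x [^] n = \<one>} = {}"
    using AB(4) closure_of_subset_topspace by fastforce
  moreover have "x \<in> W \<inter> ?P A"
    using x AB(3) \<open>x \<in> carrier G\<close> by (simp add: topspace_eq_carrier)
  ultimately show ?thesis
    using openin_Int[OF assms(2) P(1)] by blast
qed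

lemma continuous_inv_if_open_torsion:
  assumes Q: "openin X Q" "a \<in> Q" and tor: "\<And>x. x \<in> Q \<Longrightarrow> x [^] Suc n = \<one>"
  shows "continuous_map X X (\<lambda>x. inv x)"
  unfolding continuous_map_eq_topcontinuous_at topcontinuous_at_def
proof (intro ballI conjI allI impI)
  fix x assume "x \<in> topspace X"
  then have x: "x \<in> carrier G"
    by (simp add: topspace_eq_carrier)
  have a: "a \<in> carrier G"
    using Q openin_subset topspace_eq_carrier by blast
  \<comment> \<open>The translation \<open>h\<close> carries \<open>x\<close> to \<open>a\<close>.
    Where \<open>h y \<in> Q\<close>, the inverse of \<open>h y\<close> is \<open>h y [^] n\<close>,
    and solving for \<open>inv y\<close> gives \<open>g y\<close>. Only the constant
    \<open>inv x\<close> occurs in \<open>g\<close>, so its continuity does not presuppose that of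
    inversion.\<close>
  define h where "h y = (a \<otimes> inv x) \<otimes> y" for y
  define g where "g y = h y [^] n \<otimes> (a \<otimes> inv x)" for y
  have h: "continuous_map X X h"
    unfolding h_def using x a
    by (intro continuous_map_mult)
      (auto simp: topspace_eq_carrier)
  have g: "continuous_map X X g"
    unfolding g_def using x a continuous_map_compose[OF h continuous_map_nat_pow, of n]
    by (intro continuous_map_mult) (auto simp: topspace_eq_carrier o_def)
  have inv_eq: "inv y = g y" if y: "y \<in> carrier G" "h y \<in> Q" for y
  proof -
    have "g y \<otimes> y = h y [^] Suc n"
      using x a y(1) by (simp add: g_def h_def m_assoc)
    then show ?thesis
      using tor[OF y(2)] y(1) x a by (intro inv_equality) (auto simp: g_def h_def)
  qed
  show "x \<in> topspace X"
    by fact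
  show "(\<lambda>x. inv x) \<in> topspace X \<rightarrow> topspace X"
    by (simp add: topspace_eq_carrier)
  fix U assume U: "openin X U \<and> inv x \<in> U"
  have hx: "h x = a"
    using x a by (simp add: h_def m_assoc)
  let ?V = "{y \<in> topspace X. h y \<in> Q} \<inter> {y \<in> topspace X. g y \<in> U}"
  have "openin X ?V"
    using h g Q U by (intro openin_Int openin_continuous_map_preimage) auto
  moreover have "x \<in> ?V"
    using x hx Q U inv_eq[of x] by (simp add: topspace_eq_carrier)
  moreover have "\<forall>y\<in>?V. inv y \<in> U"
    using inv_eq by (simp add: topspace_eq_carrier)
  ultimately show "\<exists>V. openin X V \<and> x \<in> V \<and> (\<forall>y\<in>V. inv y \<in> U)"
    by blast
qed

end

theorem proposition3p17:
  fixes G :: "('a, 'b) monoid_scheme" and X :: "'a topology"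
  assumes "paratopological_group G X"
    and "Hausdorff_space X"
    and "feebly_compact_space X"
    and "periodic_group G"
  shows "topological_group G X"
proof -
  interpret paratopological_group G X by fact
  interpret periodic_group G by fact
  \<comment> \<open>\<open>Suc n\<close> excludes the exponent 0, for which the set would be
    everything.\<close>
  let ?F = "\<lambda>n. {x. x [^]\<^bsub>G\<^esub> Suc n = \<one>\<^bsub>G\<^esub>}"
  have "x \<in> (\<Union>n. ?F n)" if "x \<in> topspace X" for x
  proof -
    have x: "x \<in> carrier G"
      using that by (simp add: topspace_eq_carrier)
    then obtain n where "ord x = Suc n"
      using finite_ord not0_implies_Suc by blast
    then show ?thesis
      using pow_ord_eq_1[OF x] by (metis (mono_tags) UN_I UNIV_I mem_Collect_eq)
  qed
  then have cover: "topspace X \<subseteq> (\<Union>n. ?F n)"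
    by (rule subsetI)
  have ne: "topspace X \<noteq> {}"
    using topspace_eq_carrier by auto
  have "\<exists>Q n. openin X Q \<and> Q \<noteq> {} \<and> Q \<subseteq> ?F n"
  proof (rule ccontr)
    assume "\<not> ?thesis"
    \<comment> \<open>This is what \<open>shrink_avoiding_torsion\<close> needs to supply the
      shrinking hypothesis for every \<open>?F n\<close>.\<close>
    then have "\<not> Q \<subseteq> ?F n" if "openin X Q" "Q \<noteq> {}" for Q n
      using that by iprover
    then have "\<not> topspace X \<subseteq> (\<Union>n. ?F n)"
      by (intro feebly_compact_space_not_countable_Union[OF assms(3) ne]
          shrink_avoiding_torsion[OF assms(2)])
    then show False
      using cover by (rule notE)
  qed
  then obtain Q n where "openin X Q" "Q \<noteq> {}" "Q \<subseteq> ?F n"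
    by iprover
  then have "continuous_map X X (\<lambda>x. inv\<^bsub>G\<^esub> x)"
    using continuous_inv_if_open_torsion[of Q _ n] by blast
  then show ?thesis
    by unfold_locales
qed

end
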